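(* Let $\mu$ and $\nu$ be finite positive measures on measurable spaces $(X,\Sigma_X)$ and $(Y,\Sigma_Y)$ respectively, with $\|\mu\|=\|\nu\|$, and let $s\in[1,\infty]$. (1) For every Markov operator $T:\mathcal{L}^s(X,\mu)\to\mathcal{L}^s(Y,\nu)$ there exists a unique Markov transfunction $\Phi:\mathcal{M}^s_\mu\to\mathcal{M}^s_\nu$ such that $$\int_B T(1_A)\,d\nu=\Phi(1_A\mu)(B)\quad\text{for all }A\in\Sigma_X,\ B\in\Sigma_Y.$$ (2) Every Markov transfunction $\Phi:\mathcal{M}^s_\mu\to\mathcal{M}^s_\nu$ corresponds to a family of Markov operators: for every $\lambda\in\mathcal{M}^{s,+}_\mu$, setting $\rho=\Phi\lambda$, there is a Markov operator $T_{\lambda,\rho}:\mathcal{L}^\infty(X,\lambda)\to\mathcal{L}^\infty(Y,\rho)$ (with underlying measures $\lambda$ and $\rho$) satisfying $$\int_B T_{\lambda,\rho}(1_A)\,d\rho=\Phi(1_A\lambda)(B)\quad\text{for all }A\in\Sigma_X,\ B\in\Sigma_Y.$$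
   Context: All functions are real-valued. For a finite signed measure, $\|\cdot\|$ is the total variation norm. For a finite positive measure $\mu$ on $X$ and $f\in\mathcal{L}^1(X,\mu)$, $f\mu$ denotes the signed measure $A\mapsto\int_A f\,d\mu$. For $p\in[1,\infty]$, $\mathcal{M}^p_\mu=\{f\mu: f\in\mathcal{L}^p(X,\mu)\}$ and $\mathcal{M}^{p,+}_\mu=\{f\mu: f\in\mathcal{L}^p(X,\mu),\ f\ge 0\}$; similarly for $\nu$ on $Y$. Functions in $\mathcal{L}^p$ are identified when equal almost everywhere. Markov operator: for finite positive measures $\mu$ on $X$ and $\nu$ on $Y$ with $\|\mu\|=\|\nu\|$ and $p\in[1,\infty]$, a map $T:\mathcal{L}^p(X,\mu)\to\mathcal{L}^p(Y,\nu)$ is a Markov operator if (i) $T$ is linear with $T1_X=1_Y$; (ii) $f\ge0$ implies $Tf\ge0$ for all $f\in\mathcal{L}^p(X,\mu)$; (iii) $\int_X f\,d\mu=\int_Y Tf\,d\nu$ for all $f\in\mathcal{L}^p(X,\mu)$. Transfunction: a function $\Phi:\mathcal{M}_X\to\mathcal{M}_Y$ between vector spaces of finite signed measures on $X$ and $Y$. It is strongly $\sigma$-additive if it is linear and continuous with respect to total variation; positive if $\lambda\ge0$ implies $\Phi\lambda\ge0$; measure-preserving if $(\Phi\lambda)(Y)=\lambda(X)$ for all $\lambda\in\mathcal{M}_X$; Markov if it is strongly $\sigma$-additive, positive and measure-preserving. *)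

theory Defs
  imports "HOL-Analysis.Analysis"
begin

text \<open>
  The exponent \<open>p\<close> ranges over \<open>[1, \<infinity>]\<close>, as an extended nonnegative real.  \<open>Lp p M\<close> consists of
  functions rather than of classes modulo null sets; the identification of functions that agree
  almost everywhere is expressed in \<open>markov_operator\<close>, where every (in)equality between functions
  is meant almost everywhere and the operator has to respect almost-everywhere equality.
\<close>

definition Lp :: "ennreal \<Rightarrow> 'a measure \<Rightarrow> ('a \<Rightarrow> real) set" where
  "Lp p M = {f \<in> borel_measurable M.
     if p = \<infinity> then \<exists>C. AE x in M. \<bar>f x\<bar> \<le> C
     else integrable M (\<lambda>x. \<bar>f x\<bar> powr enn2real p)}"

text \<open>
  A finite signed measure on the measurable space underlying \<open>M\<close> is a real-valued set function.  Only
  \<open>space M\<close> and \<open>sets M\<close> matter here.  As for the library's \<^const>\<open>measure\<close>, the value on sets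
  outside the sigma-algebra is fixed to be \<open>0\<close>, so that equality of signed measures is equality
  in HOL.
\<close>

definition signed_measures :: "'a measure \<Rightarrow> ('a set \<Rightarrow> real) set" where
  "signed_measures M = {l.
     (\<forall>A. A \<notin> sets M \<longrightarrow> l A = 0) \<and> l {} = 0 \<and>
     (\<forall>A :: nat \<Rightarrow> 'a set. range A \<subseteq> sets M \<longrightarrow> disjoint_family A \<longrightarrow>
        (\<lambda>i. l (A i)) sums l (\<Union>i. A i))}"

definition nonneg_measure :: "'a measure \<Rightarrow> ('a set \<Rightarrow> real) \<Rightarrow> bool" where
  "nonneg_measure M l \<longleftrightarrow> (\<forall>A\<in>sets M. 0 \<le> l A)"

definition total_variation :: "'a measure \<Rightarrow> ('a set \<Rightarrow> real) \<Rightarrow> ennreal" where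
  "total_variation M l =
     (SUP P \<in> {P. finite P \<and> P \<subseteq> sets M \<and> disjoint P \<and> \<Union>P = space M}.
        \<Sum>A\<in>P. ennreal \<bar>l A\<bar>)"

text \<open>The signed measure \<open>f M\<close>; the library's \<^const>\<open>density\<close> only covers nonnegative \<open>f\<close>.\<close>

definition signed_density :: "'a measure \<Rightarrow> ('a \<Rightarrow> real) \<Rightarrow> 'a set \<Rightarrow> real" where
  "signed_density M f = (\<lambda>A. if A \<in> sets M then LINT x:A|M. f x else 0)"

definition Mp :: "ennreal \<Rightarrow> 'a measure \<Rightarrow> ('a set \<Rightarrow> real) set" where
  "Mp p M = {signed_density M f | f. f \<in> Lp p M}"

definition Mp_pos :: "ennreal \<Rightarrow> 'a measure \<Rightarrow> ('a set \<Rightarrow> real) set" where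
  "Mp_pos p M = {signed_density M f | f. f \<in> Lp p M \<and> (AE x in M. 0 \<le> f x)}"

text \<open>
  A nonnegative finite signed measure, turned into an element of the library's type of measures;
  only to be used for \<open>l \<in> signed_measures M\<close> with \<open>nonneg_measure M l\<close>.
\<close>

definition to_measure :: "'a measure \<Rightarrow> ('a set \<Rightarrow> real) \<Rightarrow> 'a measure" where
  "to_measure M l = measure_of (space M) (sets M) (\<lambda>A. ennreal (l A))"

definition markov_operator ::
  "ennreal \<Rightarrow> 'a measure \<Rightarrow> 'b measure \<Rightarrow> (('a \<Rightarrow> real) \<Rightarrow> 'b \<Rightarrow> real) \<Rightarrow> bool" where
  "markov_operator p M N T \<longleftrightarrow>
     1 \<le> p \<and> finite_measure M \<and> finite_measure N \<and>
     total_variation M (measure M) = total_variation N (measure N) \<and>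
     (\<forall>f\<in>Lp p M. T f \<in> Lp p N) \<and>
     (\<forall>f\<in>Lp p M. \<forall>g\<in>Lp p M. (AE x in M. f x = g x) \<longrightarrow> (AE y in N. T f y = T g y)) \<and>
     (\<forall>f\<in>Lp p M. \<forall>g\<in>Lp p M. AE y in N. T (\<lambda>x. f x + g x) y = T f y + T g y) \<and>
     (\<forall>c. \<forall>f\<in>Lp p M. AE y in N. T (\<lambda>x. c * f x) y = c * T f y) \<and>
     (AE y in N. T (indicator (space M)) y = indicator (space N) y) \<and>
     (\<forall>f\<in>Lp p M. (AE x in M. 0 \<le> f x) \<longrightarrow> (AE y in N. 0 \<le> T f y)) \<and>
     (\<forall>f\<in>Lp p M. (LINT x|M. f x) = (LINT y|N. T f y))"

definition signed_measure_subspace :: "'a measure \<Rightarrow> ('a set \<Rightarrow> real) set \<Rightarrow> bool" where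
  "signed_measure_subspace M V \<longleftrightarrow>
     V \<subseteq> signed_measures M \<and> (\<lambda>A. 0) \<in> V \<and>
     (\<forall>k\<in>V. \<forall>l\<in>V. (\<lambda>A. k A + l A) \<in> V) \<and>
     (\<forall>c. \<forall>l\<in>V. (\<lambda>A. c * l A) \<in> V)"

text \<open>
  A transfunction is extensional (\<^const>\<open>undefined\<close> off its domain \<open>V\<close>), so that equality
  of transfunctions, and hence uniqueness, only concerns their values on \<open>V\<close>.
\<close>

definition transfunction ::
  "'a measure \<Rightarrow> 'b measure \<Rightarrow> ('a set \<Rightarrow> real) set \<Rightarrow> ('b set \<Rightarrow> real) set \<Rightarrow>
   (('a set \<Rightarrow> real) \<Rightarrow> 'b set \<Rightarrow> real) \<Rightarrow> bool" where
  "transfunction M N V W \<Phi> \<longleftrightarrow>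
     signed_measure_subspace M V \<and> signed_measure_subspace N W \<and> \<Phi> \<in> V \<rightarrow>\<^sub>E W"

definition strongly_sigma_additive ::
  "'a measure \<Rightarrow> 'b measure \<Rightarrow> ('a set \<Rightarrow> real) set \<Rightarrow>
   (('a set \<Rightarrow> real) \<Rightarrow> 'b set \<Rightarrow> real) \<Rightarrow> bool" where
  "strongly_sigma_additive M N V \<Phi> \<longleftrightarrow>
     (\<forall>k\<in>V. \<forall>l\<in>V. \<Phi> (\<lambda>A. k A + l A) = (\<lambda>B. \<Phi> k B + \<Phi> l B)) \<and>
     (\<forall>c. \<forall>l\<in>V. \<Phi> (\<lambda>A. c * l A) = (\<lambda>B. c * \<Phi> l B)) \<and>
     (\<forall>l\<in>V. \<forall>e::real. 0 < e \<longrightarrow> (\<exists>d::real. 0 < d \<and>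
        (\<forall>k\<in>V. total_variation M (\<lambda>A. k A - l A) < ennreal d \<longrightarrow>
           total_variation N (\<lambda>B. \<Phi> k B - \<Phi> l B) < ennreal e)))"

definition markov_transfunction ::
  "'a measure \<Rightarrow> 'b measure \<Rightarrow> ('a set \<Rightarrow> real) set \<Rightarrow> ('b set \<Rightarrow> real) set \<Rightarrow>
   (('a set \<Rightarrow> real) \<Rightarrow> 'b set \<Rightarrow> real) \<Rightarrow> bool" where
  "markov_transfunction M N V W \<Phi> \<longleftrightarrow>
     transfunction M N V W \<Phi> \<and>
     strongly_sigma_additive M N V \<Phi> \<and>
     (\<forall>l\<in>V. nonneg_measure M l \<longrightarrow> nonneg_measure N (\<Phi> l)) \<and>
     (\<forall>l\<in>V. \<Phi> l (space N) = l (space M))"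

end

theory Submission imports Defs
begin

text \<open>
  For (1), the transfunction sends \<open>f \<mu>\<close> to \<open>(T f) \<nu>\<close>; it is a contraction because
  \<open>\<bar>T f\<bar> \<le> T \<bar>f\<bar>\<close> and the total variation of \<open>f \<mu>\<close> is the integral of \<open>\<bar>f\<bar>\<close>.  Uniqueness
  holds because every \<open>f\<close> in \<open>L\<^sup>s\<close> is an \<open>L\<^sup>1\<close>-limit of simple functions.

  For (2), write \<open>\<lambda> = h \<mu>\<close> and \<open>\<rho> = k \<nu>\<close>.  If \<open>\<bar>f\<bar> \<le> C\<close>, positivity bounds the density \<open>g\<close> of
  \<open>\<Phi> (f \<lambda>)\<close> by \<open>\<bar>g\<bar> \<le> C k\<close>, so \<open>T f = g / k\<close> is essentially bounded with respect to \<open>\<rho>\<close> and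
  \<open>(T f) \<rho> = \<Phi> (f \<lambda>)\<close>.  This equation determines \<open>T f\<close> almost everywhere, and the Markov
  properties of \<open>T\<close> follow from those of \<open>\<Phi>\<close>.
\<close>

section \<open>The spaces \<open>L\<^sup>p\<close>\<close>

lemma Lp_measurable: "f \<in> Lp p M \<Longrightarrow> f \<in> borel_measurable M"
  by (simp add: Lp_def)

lemma enn2real_ge_one: "1 \<le> p \<Longrightarrow> p \<noteq> \<infinity> \<Longrightarrow> 1 \<le> enn2real p"
  by (metis enn2real_1 enn2real_mono infinity_ennreal_def top.not_eq_extremum)

text \<open>Constants are integrable over a finite measure, and for an exponent
  \<open>q >= 1\<close> the bound \<open>|f| <= 1 + |f| powr q\<close> holds pointwise. This
  inclusion in \<open>L^1\<close> gives every signed density its meaning.\<close>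

lemma Lp_integrable:
  assumes "finite_measure M" "1 \<le> p" and f: "f \<in> Lp p M"
  shows "integrable M f"
proof -
  interpret finite_measure M by fact
  have [measurable]: "f \<in> borel_measurable M" using f by (rule Lp_measurable)
  show ?thesis
  proof (cases "p = \<infinity>")
    case True
    then obtain C where "AE x in M. \<bar>f x\<bar> \<le> C" using f by (auto simp: Lp_def)
    then show ?thesis by (intro integrable_const_bound[of _ C]) auto
  next
    case False
    let ?q = "enn2real p"
    have "\<bar>f x\<bar> \<le> 1 + \<bar>f x\<bar> powr ?q" for x
    proof (cases "\<bar>f x\<bar> \<le> 1")
      case False
      then have "\<bar>f x\<bar> powr 1 \<le> \<bar>f x\<bar> powr ?q"
        using enn2real_ge_one[OF assms(2) \<open>p \<noteq> \<infinity>\<close>] by (intro powr_mono) auto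
      then show ?thesis by simp
    qed (simp add: add_increasing2)
    then have le: "AE x in M. norm (f x) \<le> norm (1 + \<bar>f x\<bar> powr ?q)"
      by (intro AE_I2) auto
    have "integrable M (\<lambda>x. 1 + \<bar>f x\<bar> powr ?q)"
      using f False by (auto simp: Lp_def)
    then show ?thesis by (rule Bochner_Integration.integrable_bound[OF _ _ le]) measurable
  qed
qed

text \<open>Monotonicity of the integral, or of the essential bound, under domination by a multiple
  of \<open>f\<close>. Most closure properties of \<open>Lp\<close> below reduce to this.\<close>

lemma Lp_bound:
  assumes f: "f \<in> Lp p M" and [measurable]: "g \<in> borel_measurable M"
    and le: "AE x in M. \<bar>g x\<bar> \<le> C * \<bar>f x\<bar>"
  shows "g \<in> Lp p M"
proof (cases "p = \<infinity>")
  case True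
  then obtain D where "AE x in M. \<bar>f x\<bar> \<le> D" using f by (auto simp: Lp_def)
  \<comment> \<open>The sign of \<open>C\<close> is unknown, so \<open>|C|\<close> replaces it
    before the bound on \<open>f\<close> is multiplied.\<close>
  with le have "AE x in M. \<bar>g x\<bar> \<le> \<bar>C\<bar> * D"
  proof eventually_elim
    case (elim x)
    have "C * \<bar>f x\<bar> \<le> \<bar>C\<bar> * \<bar>f x\<bar>" by (intro mult_right_mono) auto
    also have "\<dots> \<le> \<bar>C\<bar> * D" using elim by (intro mult_left_mono) auto
    finally show ?case using elim by simp
  qed
  then show ?thesis using True by (auto simp: Lp_def)
next
  case False
  have [measurable]: "f \<in> borel_measurable M" using f by (rule Lp_measurable)
  let ?q = "enn2real p"
  have bound: "AE x in M. norm (\<bar>g x\<bar> powr ?q) \<le> norm (\<bar>C\<bar> powr ?q * \<bar>f x\<bar> powr ?q)"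
    using le
  proof eventually_elim
    case (elim x)
    have "C * \<bar>f x\<bar> \<le> \<bar>C\<bar> * \<bar>f x\<bar>" by (intro mult_right_mono) auto
    then have "\<bar>g x\<bar> powr ?q \<le> (\<bar>C\<bar> * \<bar>f x\<bar>) powr ?q"
      using elim by (intro powr_mono2) auto
    then show ?case by (simp add: powr_mult)
  qed
  have "integrable M (\<lambda>x. \<bar>C\<bar> powr ?q * \<bar>f x\<bar> powr ?q)"
    using f False by (auto simp: Lp_def)
  then have "integrable M (\<lambda>x. \<bar>g x\<bar> powr ?q)"
    by (rule Bochner_Integration.integrable_bound[OF _ _ bound]) measurable
  then show ?thesis using False by (auto simp: Lp_def)
qed

lemma Lp_one: "finite_measure M \<Longrightarrow> (\<lambda>x. 1) \<in> Lp p M"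
  by (auto simp: Lp_def finite_measure.integrable_const)

lemma Lp_bounded:
  assumes "finite_measure M" "g \<in> borel_measurable M" "AE x in M. \<bar>g x\<bar> \<le> C"
  shows "g \<in> Lp p M"
  using assms by (intro Lp_bound[OF Lp_one, where C=C]) auto

lemma Lp_indicator: "finite_measure M \<Longrightarrow> A \<in> sets M \<Longrightarrow> indicator A \<in> Lp p M"
  by (intro Lp_bounded[where C=1]) (auto simp: indicator_def)

lemma Lp_cmult: "f \<in> Lp p M \<Longrightarrow> (\<lambda>x. c * f x) \<in> Lp p M"
  by (rule Lp_bound[where C="\<bar>c\<bar>"]) (auto simp: abs_mult dest: Lp_measurable)

lemma Lp_abs: "f \<in> Lp p M \<Longrightarrow> (\<lambda>x. \<bar>f x\<bar>) \<in> Lp p M"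
  by (rule Lp_bound[where C=1]) (auto dest: Lp_measurable)

text \<open>Minkowski's inequality is avoided: the power of a maximum is at most the sum of the
  powers, so \<open>max |f| |g|\<close> lies in \<open>Lp\<close>, and \<open>|f + g|\<close> is at
  most twice this maximum.\<close>

lemma Lp_add:
  assumes f: "f \<in> Lp p M" and g: "g \<in> Lp p M"
  shows "(\<lambda>x. f x + g x) \<in> Lp p M"
proof -
  have [measurable]: "f \<in> borel_measurable M" "g \<in> borel_measurable M"
    using f g by (auto dest: Lp_measurable)
  let ?m = "\<lambda>x. max \<bar>f x\<bar> \<bar>g x\<bar>"
  have "?m \<in> Lp p M"
  proof (cases "p = \<infinity>")
    case True
    then obtain C D where "AE x in M. \<bar>f x\<bar> \<le> C" "AE x in M. \<bar>g x\<bar> \<le> D"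
      using f g by (auto simp: Lp_def)
    then have "AE x in M. \<bar>?m x\<bar> \<le> max C D" by eventually_elim auto
    then show ?thesis using True by (auto simp: Lp_def)
  next
    case False
    let ?q = "enn2real p"
    have "integrable M (\<lambda>x. \<bar>f x\<bar> powr ?q + \<bar>g x\<bar> powr ?q)"
      using f g False by (auto simp: Lp_def)
    then have "integrable M (\<lambda>x. \<bar>?m x\<bar> powr ?q)"
      by (rule Bochner_Integration.integrable_bound) (auto simp: max_def)
    then show ?thesis using False by (auto simp: Lp_def)
  qed
  then show ?thesis by (rule Lp_bound[where C=2]) auto
qed

lemma Lp_diff: "f \<in> Lp p M \<Longrightarrow> g \<in> Lp p M \<Longrightarrow> (\<lambda>x. f x - g x) \<in> Lp p M"
  using Lp_add[of f p M "\<lambda>x. - 1 * g x"] Lp_cmult[of g p M "-1"] by simp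

section \<open>Signed densities and their total variation\<close>

lemma integrable_set_integrable:
  fixes f :: "'a \<Rightarrow> real"
  shows "integrable M f \<Longrightarrow> A \<in> sets M \<Longrightarrow> set_integrable M A f"
  unfolding set_integrable_def by (rule integrable_mult_indicator)

lemma signed_density_add:
  "integrable M f \<Longrightarrow> integrable M g \<Longrightarrow>
   signed_density M (\<lambda>x. f x + g x) = (\<lambda>A. signed_density M f A + signed_density M g A)"
  by (auto simp: signed_density_def fun_eq_iff set_integral_add integrable_set_integrable)

lemma signed_density_diff:
  "integrable M f \<Longrightarrow> integrable M g \<Longrightarrow>
   signed_density M (\<lambda>x. f x - g x) = (\<lambda>A. signed_density M f A - signed_density M g A)"
  by (auto simp: signed_density_def fun_eq_iff set_integral_diff integrable_set_integrable)

lemma signed_density_cmult: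
  "signed_density M (\<lambda>x. c * f x) = (\<lambda>A. c * signed_density M f A)"
  by (auto simp: signed_density_def fun_eq_iff)

lemma signed_density_cong_AE:
  assumes "f \<in> borel_measurable M" "g \<in> borel_measurable M" "AE x in M. f x = g x"
  shows "signed_density M f = signed_density M g"
  unfolding signed_density_def fun_eq_iff using assms
  by (auto intro!: set_lebesgue_integral_cong_AE)

text \<open>Uniqueness of Radon-Nikodym densities. It turns identities between measures into
  almost-everywhere identities between functions, in both directions of the correspondence.\<close>

lemma signed_density_eq_AE:
  assumes "integrable M f" "integrable M g" "signed_density M f = signed_density M g"
  shows "AE x in M. f x = g x"
  using assms by (intro density_unique_real) (auto simp: signed_density_def fun_eq_iff split: if_splits)

lemma signed_density_space: "signed_density M f (space M) = (LINT x|M. f x)"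
  by (auto simp: signed_density_def set_lebesgue_integral_def intro!: Bochner_Integration.integral_cong)

lemma nonneg_signed_density_iff:
  assumes "finite_measure M" "integrable M f"
  shows "nonneg_measure M (signed_density M f) \<longleftrightarrow> (AE x in M. 0 \<le> f x)"
proof
  interpret finite_measure M by fact
  assume "nonneg_measure M (signed_density M f)"
  then show "AE x in M. 0 \<le> f x"
    using assms by (intro density_nonneg) (auto simp: nonneg_measure_def signed_density_def)
next
  assume f: "AE x in M. 0 \<le> f x"
  have "0 \<le> (LINT x:A|M. f x)" for A
    unfolding set_lebesgue_integral_def using f
    by (intro integral_nonneg_AE) (auto simp: indicator_def)
  then show "nonneg_measure M (signed_density M f)" by (auto simp: nonneg_measure_def signed_density_def)
qed

text \<open>Finite additivity of the set integral, followed by its continuity along the increasing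
  unions of the first \<open>n\<close> sets.\<close>

lemma signed_density_in_signed_measures:
  assumes f: "integrable M f"
  shows "signed_density M f \<in> signed_measures M"
proof -
  have "(\<lambda>i. signed_density M f (A i)) sums signed_density M f (\<Union>i. A i)"
    if A: "range A \<subseteq> sets M" "disjoint_family A" for A :: "nat \<Rightarrow> 'a set"
  proof -
    have Ai: "A i \<in> sets M" for i using A by auto
    have "(\<lambda>n. LINT x:(\<Union>i<n. A i)|M. f x) \<longlonglongrightarrow> (LINT x:(\<Union>n. \<Union>i<n. A i)|M. f x)"
      using Ai by (intro set_integral_cont_up integrable_set_integrable[OF f])
        (auto simp: incseq_def intro: less_le_trans)
    also have "(\<Union>n. \<Union>i<n. A i) = (\<Union>i. A i)" by blast
    also have "(\<lambda>n. LINT x:(\<Union>i<n. A i)|M. f x) = (\<lambda>n. \<Sum>i<n. LINT x:A i|M. f x)"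
      using A(2) Ai by (intro ext set_integral_finite_Union integrable_set_integrable[OF f])
        (auto simp: disjoint_family_on_def)
    finally show ?thesis using Ai by (auto simp: sums_def signed_density_def)
  qed
  then show ?thesis
    by (auto simp: signed_measures_def signed_density_def set_lebesgue_integral_def)
qed

lemma Mp_subspace:
  assumes M: "finite_measure M" "1 \<le> p"
  shows "signed_measure_subspace M (Mp p M)"
  unfolding signed_measure_subspace_def
proof (intro conjI ballI allI)
  note int = Lp_integrable[OF M]
  show "Mp p M \<subseteq> signed_measures M"
    by (auto simp: Mp_def intro!: signed_density_in_signed_measures int)
  show "(\<lambda>A. 0) \<in> Mp p M"
    using Lp_cmult[OF Lp_one[OF M(1)], of 0 p] signed_density_cmult[of M 0 "\<lambda>x. 1"]
    unfolding Mp_def by force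
  show "(\<lambda>A. k A + l A) \<in> Mp p M" if "k \<in> Mp p M" "l \<in> Mp p M" for k l
    using that by (auto simp: Mp_def intro: Lp_add signed_density_add[OF int int, symmetric])
  show "(\<lambda>A. c * l A) \<in> Mp p M" if "l \<in> Mp p M" for c l
    using that by (auto simp: Mp_def intro: Lp_cmult signed_density_cmult[symmetric])
qed

section \<open>Total variation of a signed density as the \<open>L^1\<close> norm of the
  density\<close>

lemma total_variation_le_integral_abs:
  assumes f: "integrable M f"
  shows "total_variation M (signed_density M f) \<le> ennreal (LINT x|M. \<bar>f x\<bar>)"
  unfolding total_variation_def
proof (rule SUP_least, clarify)
  fix P assume P: "finite P" "P \<subseteq> sets M" "disjoint P" "\<Union>P = space M"
  have abs: "integrable M (\<lambda>x. \<bar>f x\<bar>)" using f by simp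
  \<comment> \<open>The triangle inequality is applied on each cell; the cells are disjoint and
    cover the space, so the bounds add up to the full integral.\<close>
  have "\<bar>signed_density M f A\<bar> \<le> (LINT x:A|M. \<bar>f x\<bar>)" if "A \<in> P" for A
    using that P(2) integral_abs_bound[of M "\<lambda>x. indicator A x *\<^sub>R f x"]
    by (auto simp: signed_density_def set_lebesgue_integral_def abs_mult)
  then have "(\<Sum>A\<in>P. \<bar>signed_density M f A\<bar>) \<le> (\<Sum>A\<in>P. LINT x:A|M. \<bar>f x\<bar>)"
    by (rule sum_mono)
  also have "\<dots> = (LINT x:(\<Union>A\<in>P. A)|M. \<bar>f x\<bar>)"
    using P by (intro set_integral_finite_Union[symmetric] integrable_set_integrable abs)
      (auto simp: disjoint_family_on_def disjoint_def)
  also have "\<dots> = (LINT x|M. \<bar>f x\<bar>)"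
    using P(4) signed_density_space[of M "\<lambda>x. \<bar>f x\<bar>"] by (simp add: signed_density_def)
  finally show "(\<Sum>A\<in>P. ennreal \<bar>signed_density M f A\<bar>) \<le> ennreal (LINT x|M. \<bar>f x\<bar>)"
    by (simp add: ennreal_leI)
qed

text \<open>The Hahn decomposition into \<open>0 <= f\<close> and its complement is a partition that
  already attains the integral.\<close>

lemma integral_abs_le_total_variation:
  assumes f: "integrable M f"
  shows "ennreal (LINT x|M. \<bar>f x\<bar>) \<le> total_variation M (signed_density M f)"
proof -
  have [measurable]: "f \<in> borel_measurable M" using f by auto
  define A where "A = {x\<in>space M. 0 \<le> f x}"
  have A[measurable]: "A \<in> sets M" unfolding A_def by measurable
  let ?B = "space M - A"
  \<comment> \<open>The sum below runs over the set \<open>{A, ?B}\<close>, which would lose a term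
    if both cells coincided; this can happen only on the empty space.\<close>
  have d: "A \<noteq> ?B \<or> space M = {}" unfolding A_def by auto
  have "(LINT x|M. \<bar>f x\<bar>) = (LINT x|M. indicator A x *\<^sub>R f x - indicator ?B x *\<^sub>R f x)"
    by (intro Bochner_Integration.integral_cong) (auto simp: A_def indicator_def)
  also have "\<dots> = signed_density M f A - signed_density M f ?B"
    by (auto simp: signed_density_def set_lebesgue_integral_def simp del: real_scaleR_def
        intro!: Bochner_Integration.integral_diff integrable_mult_indicator f)
  also have "\<dots> \<le> \<bar>signed_density M f A\<bar> + \<bar>signed_density M f ?B\<bar>" by simp
  finally have "ennreal (LINT x|M. \<bar>f x\<bar>) \<le> ennreal \<bar>signed_density M f A\<bar> + ennreal \<bar>signed_density M f ?B\<bar>"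
    by (simp add: ennreal_leI flip: ennreal_plus)
  also have "\<dots> = (\<Sum>A\<in>{A, ?B}. ennreal \<bar>signed_density M f A\<bar>)"
    using d
  proof
    assume "space M = {}"
    then have "A = {}" by (auto simp: A_def)
    then show ?thesis using \<open>space M = {}\<close> by (simp add: signed_density_def set_lebesgue_integral_def)
  qed simp
  also have "\<dots> \<le> total_variation M (signed_density M f)"
    unfolding total_variation_def
    using A sets.sets_into_space[OF A] by (intro SUP_upper) (auto simp: disjoint_def)
  finally show ?thesis .
qed

text \<open>Continuity with respect to total variation thereby becomes continuity in the
  \<open>L^1\<close> distance of densities.\<close>

lemma total_variation_signed_density:
  "integrable M f \<Longrightarrow> total_variation M (signed_density M f) = ennreal (LINT x|M. \<bar>f x\<bar>)"
  by (intro antisym total_variation_le_integral_abs integral_abs_le_total_variation)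

text \<open>The measure is its own density with \<open>f = 1\<close>. The norm condition in
  \<open>markov_operator\<close> thus becomes equality of total masses.\<close>

lemma total_variation_measure:
  assumes "finite_measure M"
  shows "total_variation M (measure M) = ennreal (measure M (space M))"
proof -
  interpret finite_measure M by fact
  have "measure M = signed_density M (\<lambda>x. 1)"
    by (auto simp: signed_density_def fun_eq_iff measure_notin_sets set_lebesgue_integral_def)
  then show ?thesis using total_variation_signed_density[of M "\<lambda>x. 1"] by simp
qed

text \<open>The partition into \<open>B\<close> and its complement gives the bound. It makes
  evaluation at \<open>B\<close> continuous, as the uniqueness proof requires.\<close>

lemma abs_le_total_variation:
  assumes "B \<in> sets N"
  shows "ennreal \<bar>l B\<bar> \<le> total_variation N l"
proof -
  let ?P = "{B, space N - B}"
  have "ennreal \<bar>l B\<bar> \<le> (\<Sum>A\<in>?P. ennreal \<bar>l A\<bar>)" by (rule member_le_sum) auto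
  also have "\<dots> \<le> total_variation N l"
    unfolding total_variation_def
    using assms sets.sets_into_space[OF assms] by (intro SUP_upper) (auto simp: disjoint_def)
  finally show ?thesis .
qed

section \<open>Nonnegative signed densities as base measures\<close>

lemma to_measure_signed_density:
  assumes f: "integrable M f" "AE x in M. 0 \<le> f x"
  shows "to_measure M (signed_density M f) = density M (\<lambda>x. ennreal (f x))"
  unfolding to_measure_def density_def
proof (rule measure_of_eq)
  show "sets M \<subseteq> Pow (space M)" by (rule sets.space_closed)
  fix A assume "A \<in> sigma_sets (space M) (sets M)"
  then have A: "A \<in> sets M" by (simp add: sets.sigma_sets_eq)
  have "ennreal (signed_density M f A) = (\<integral>\<^sup>+ x. ennreal (indicator A x *\<^sub>R f x) \<partial>M)"
    using A f unfolding signed_density_def set_lebesgue_integral_def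
    by (subst nn_integral_eq_integral[OF integrable_mult_indicator]) (auto simp: indicator_def)
  also have "\<dots> = (\<integral>\<^sup>+ x. ennreal (f x) * indicator A x \<partial>M)"
    by (intro nn_integral_cong) (auto simp: indicator_def)
  finally show "ennreal (signed_density M f A) = (\<integral>\<^sup>+ x. ennreal (f x) * indicator A x \<partial>M)" .
qed

text \<open>Chain rule for densities. It expresses a signed measure over
  \<open>to_measure M l\<close> as one over \<open>M\<close>, where a transfunction on
  \<open>Mp p M\<close> can act on it.\<close>

lemma signed_density_density:
  fixes f :: "'a \<Rightarrow> real"
  assumes [measurable]: "f \<in> borel_measurable M" "h \<in> borel_measurable M"
    and h: "AE x in M. 0 \<le> h x"
  shows "signed_density (density M (\<lambda>x. ennreal (h x))) f = signed_density M (\<lambda>x. h x * f x)"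
  unfolding signed_density_def fun_eq_iff set_lebesgue_integral_def using h
  by (auto simp: integral_density mult.left_commute)

section \<open>From Markov operators to Markov transfunctions\<close>

text \<open>Positivity is applied to \<open>|f| + f\<close> and \<open>|f| - f\<close>, which yields
  \<open>|T f| <= T |f|\<close> almost everywhere; integrating and using that \<open>T\<close>
  preserves integrals finishes the estimate.\<close>

lemma markov_operator_contraction:
  assumes T: "markov_operator p M N T" and f: "f \<in> Lp p M"
  shows "(LINT y|N. \<bar>T f y\<bar>) \<le> (LINT x|M. \<bar>f x\<bar>)"
proof -
  have fin: "finite_measure N" "1 \<le> p"
    and Lp: "\<And>f. f \<in> Lp p M \<Longrightarrow> T f \<in> Lp p N"
    and add: "\<And>f g. f \<in> Lp p M \<Longrightarrow> g \<in> Lp p M \<Longrightarrow>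
      AE y in N. T (\<lambda>x. f x + g x) y = T f y + T g y"
    and cmult: "\<And>c f. f \<in> Lp p M \<Longrightarrow> AE y in N. T (\<lambda>x. c * f x) y = c * T f y"
    and pos: "\<And>f. f \<in> Lp p M \<Longrightarrow> AE x in M. 0 \<le> f x \<Longrightarrow> AE y in N. 0 \<le> T f y"
    and int: "\<And>f. f \<in> Lp p M \<Longrightarrow> (LINT x|M. f x) = (LINT y|N. T f y)"
    using T by (auto simp: markov_operator_def)
  have a: "(\<lambda>x. \<bar>f x\<bar>) \<in> Lp p M" and c: "(\<lambda>x. c * f x) \<in> Lp p M" for c
    using f by (auto intro: Lp_abs Lp_cmult)
  have "AE y in N. 0 \<le> T (\<lambda>x. \<bar>f x\<bar>) y + c * T f y" if "\<bar>c\<bar> = 1" for c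
  proof -
    have "AE x in M. 0 \<le> \<bar>f x\<bar> + c * f x"
      using that by (intro AE_I2) (auto simp: abs_if split: if_splits)
    from pos[OF Lp_add[OF a c] this] add[OF a c, of c] cmult[OF f, of c]
    show ?thesis by eventually_elim simp
  qed
  from this[of 1] this[of "-1"] have "AE y in N. \<bar>T f y\<bar> \<le> T (\<lambda>x. \<bar>f x\<bar>) y" by auto
  then have "(LINT y|N. \<bar>T f y\<bar>) \<le> (LINT y|N. T (\<lambda>x. \<bar>f x\<bar>) y)"
    using Lp_integrable[OF fin Lp] f a by (intro integral_mono_AE) auto
  then show ?thesis using int[OF a] by simp
qed

text \<open>Each property of \<open>T\<close> passes to the measure
  \<open>signed_density N (T f)\<close>, since a signed density depends only on the
  almost-everywhere class of its function.\<close>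

lemma markov_operator_induces_transfunction:
  assumes T: "markov_operator p M N T"
  obtains \<Phi> where "markov_transfunction M N (Mp p M) (Mp p N) \<Phi>"
    and "\<And>f. f \<in> Lp p M \<Longrightarrow> \<Phi> (signed_density M f) = signed_density N (T f)"
proof -
  have fin: "finite_measure M" "finite_measure N" "1 \<le> p"
    and Lp: "\<And>f. f \<in> Lp p M \<Longrightarrow> T f \<in> Lp p N"
    and cong: "\<And>f g. f \<in> Lp p M \<Longrightarrow> g \<in> Lp p M \<Longrightarrow> AE x in M. f x = g x \<Longrightarrow>
      AE y in N. T f y = T g y"
    and add: "\<And>f g. f \<in> Lp p M \<Longrightarrow> g \<in> Lp p M \<Longrightarrow>
      AE y in N. T (\<lambda>x. f x + g x) y = T f y + T g y"
    and cmult: "\<And>c f. f \<in> Lp p M \<Longrightarrow> AE y in N. T (\<lambda>x. c * f x) y = c * T f y"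
    and pos: "\<And>f. f \<in> Lp p M \<Longrightarrow> AE x in M. 0 \<le> f x \<Longrightarrow> AE y in N. 0 \<le> T f y"
    and int: "\<And>f. f \<in> Lp p M \<Longrightarrow> (LINT x|M. f x) = (LINT y|N. T f y)"
    using T by (auto simp: markov_operator_def)
  note intM = Lp_integrable[OF fin(1,3)] and intN = Lp_integrable[OF fin(2,3)]
  \<comment> \<open>Some density of \<open>l\<close> is chosen; any two agree almost everywhere and
    \<open>T\<close> respects this, so the choice does not matter. The restriction supplies
    extensionality.\<close>
  define \<Phi> where "\<Phi> = restrict (\<lambda>l. signed_density N
      (T (SOME f. f \<in> Lp p M \<and> l = signed_density M f))) (Mp p M)"
  have \<Phi>: "\<Phi> (signed_density M f) = signed_density N (T f)" if f: "f \<in> Lp p M" for f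
  proof -
    let ?g = "SOME g. g \<in> Lp p M \<and> signed_density M f = signed_density M g"
    have g: "?g \<in> Lp p M \<and> signed_density M f = signed_density M ?g"
      by (rule someI[of _ f]) (use f in auto)
    have "AE x in M. ?g x = f x"
      using f g by (intro signed_density_eq_AE intM) auto
    then have "signed_density N (T ?g) = signed_density N (T f)"
      using f g by (intro signed_density_cong_AE cong Lp Lp_measurable[OF Lp]) auto
    then show ?thesis using f by (auto simp: \<Phi>_def Mp_def)
  qed
  have MpE: "\<exists>f\<in>Lp p M. l = signed_density M f" if "l \<in> Mp p M" for l
    using that by (auto simp: Mp_def)
  have \<Phi>_add: "\<Phi> (\<lambda>A. k A + l A) = (\<lambda>B. \<Phi> k B + \<Phi> l B)"
    if kl: "k \<in> Mp p M" "l \<in> Mp p M" for k l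
  proof -
    from MpE[OF kl(1)] MpE[OF kl(2)] obtain f g where
      f: "f \<in> Lp p M" "k = signed_density M f" and g: "g \<in> Lp p M" "l = signed_density M g" by auto
    have "\<Phi> (\<lambda>A. k A + l A) = signed_density N (T (\<lambda>x. f x + g x))"
      using f g by (simp add: signed_density_add[OF intM intM, symmetric] \<Phi> Lp_add)
    also have "\<dots> = signed_density N (\<lambda>y. T f y + T g y)"
      using f g by (intro signed_density_cong_AE add borel_measurable_add Lp_measurable[OF Lp] Lp_add)
    finally show ?thesis using f g by (simp add: signed_density_add intN Lp \<Phi>)
  qed
  have \<Phi>_cmult: "\<Phi> (\<lambda>A. c * l A) = (\<lambda>B. c * \<Phi> l B)" if l: "l \<in> Mp p M" for c l
  proof -
    from MpE[OF l] obtain f where f: "f \<in> Lp p M" "l = signed_density M f" by auto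
    have "\<Phi> (\<lambda>A. c * l A) = signed_density N (T (\<lambda>x. c * f x))"
      using f by (simp add: signed_density_cmult[symmetric] \<Phi> Lp_cmult)
    also have "\<dots> = signed_density N (\<lambda>y. c * T f y)"
      using f by (intro signed_density_cong_AE cmult borel_measurable_times borel_measurable_const
          Lp_measurable[OF Lp] Lp_cmult)
    finally show ?thesis using f by (simp add: signed_density_cmult \<Phi>)
  qed
  have \<Phi>_tv: "total_variation N (\<lambda>B. \<Phi> k B - \<Phi> l B) \<le> total_variation M (\<lambda>A. k A - l A)"
    if kl: "k \<in> Mp p M" "l \<in> Mp p M" for k l
  proof -
    \<comment> \<open>The difference is written as a sum with \<open>-1 * l\<close>, so that
      linearity reduces the Lipschitz bound to the contraction estimate for
      \<open>f - g\<close>.\<close>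
    have "(\<lambda>A. -1 * l A) \<in> Mp p M"
      using Mp_subspace[OF fin(1,3)] kl(2) unfolding signed_measure_subspace_def by blast
    from \<Phi>_add[OF kl(1) this] \<Phi>_cmult[OF kl(2), of "-1"]
    have 1: "(\<lambda>B. \<Phi> k B - \<Phi> l B) = \<Phi> (\<lambda>A. k A - l A)" by simp
    from MpE[OF kl(1)] MpE[OF kl(2)] obtain f g where
      f: "f \<in> Lp p M" "k = signed_density M f" and g: "g \<in> Lp p M" "l = signed_density M g" by auto
    then have 2: "(\<lambda>A. k A - l A) = signed_density M (\<lambda>x. f x - g x)"
      by (simp add: signed_density_diff intM)
    have fg: "(\<lambda>x. f x - g x) \<in> Lp p M" using f g by (intro Lp_diff)
    show ?thesis
      unfolding 1 unfolding 2 \<Phi>[OF fg]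
      by (simp add: total_variation_signed_density intN intM Lp fg ennreal_leI
          markov_operator_contraction[OF T])
  qed
  have "markov_transfunction M N (Mp p M) (Mp p N) \<Phi>"
    unfolding markov_transfunction_def transfunction_def strongly_sigma_additive_def
  proof (intro conjI ballI allI impI Mp_subspace fin)
    show "\<Phi> \<in> Mp p M \<rightarrow>\<^sub>E Mp p N"
    proof (rule PiE_I)
      show "\<Phi> l \<in> Mp p N" if "l \<in> Mp p M" for l
        using MpE[OF that] \<Phi> Lp by (auto simp: Mp_def)
    qed (simp add: \<Phi>_def)
    show "\<exists>d>0. \<forall>k\<in>Mp p M. total_variation M (\<lambda>A. k A - l A) < ennreal d \<longrightarrow>
        total_variation N (\<lambda>B. \<Phi> k B - \<Phi> l B) < ennreal e"
      if "l \<in> Mp p M" "0 < e" for l e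
      using that \<Phi>_tv by (intro exI[of _ e]) (auto intro: le_less_trans)
    show "nonneg_measure N (\<Phi> l)" if l: "l \<in> Mp p M" "nonneg_measure M l" for l
      using MpE[OF l(1)] l(2) by (auto simp: \<Phi> nonneg_signed_density_iff fin intM intN Lp pos)
    show "\<Phi> l (space N) = l (space M)" if "l \<in> Mp p M" for l
      using MpE[OF that] by (auto simp: \<Phi> signed_density_space int)
  qed (auto intro: \<Phi>_add \<Phi>_cmult)
  then show thesis using \<Phi> that by blast
qed

text \<open>Agreement on indicators extends to simple functions by linearity and to all of
  \<open>Lp\<close> by continuity. As continuity refers to total variation, \<open>L^1\<close>
  convergence of the approximating densities suffices for every \<open>p\<close>, including
  infinity.\<close>

lemma transfunction_eqI:
  assumes fin: "finite_measure M" "1 \<le> p"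
    and \<Phi>: "transfunction M N (Mp p M) W \<Phi>" "strongly_sigma_additive M N (Mp p M) \<Phi>"
    and \<Psi>: "transfunction M N (Mp p M) W \<Psi>" "strongly_sigma_additive M N (Mp p M) \<Psi>"
    and eq: "\<And>A B. A \<in> sets M \<Longrightarrow> B \<in> sets N \<Longrightarrow>
      \<Phi> (signed_density M (indicator A)) B = \<Psi> (signed_density M (indicator A)) B"
  shows "\<Phi> = \<Psi>"
proof -
  interpret finite_measure M by fact
  have Mp: "signed_density M f \<in> Mp p M" if "f \<in> Lp p M" for f
    using that by (auto simp: Mp_def)
  \<comment> \<open>Signed measures vanish off the sigma-algebra, so agreement on measurable
    \<open>B\<close> gives equality as functions.\<close>
  have out: "\<Theta> l B = 0"
    if "transfunction M N (Mp p M) W \<Theta>" "l \<in> Mp p M" "B \<notin> sets N" for \<Theta> l B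
  proof -
    have "\<Theta> l \<in> signed_measures N"
      using that by (auto simp: transfunction_def signed_measure_subspace_def)
    then show ?thesis using that by (auto simp: signed_measures_def)
  qed
  have ind: "\<Phi> (signed_density M (indicator A)) = \<Psi> (signed_density M (indicator A))"
    if A: "A \<in> sets M" for A
  proof
    fix B
    show "\<Phi> (signed_density M (indicator A)) B = \<Psi> (signed_density M (indicator A)) B"
      using eq[OF A] out[OF \<Phi>(1) Mp[OF Lp_indicator[OF fin(1) A]]]
        out[OF \<Psi>(1) Mp[OF Lp_indicator[OF fin(1) A]]] by (cases "B \<in> sets N") auto
  qed
  have lin_add: "\<Theta> (signed_density M (\<lambda>x. f x + g x)) =
      (\<lambda>B. \<Theta> (signed_density M f) B + \<Theta> (signed_density M g) B)"
    if "strongly_sigma_additive M N (Mp p M) \<Theta>" "f \<in> Lp p M" "g \<in> Lp p M" for f g \<Theta>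
    using that by (simp add: strongly_sigma_additive_def signed_density_add Lp_integrable[OF fin] Mp)
  have lin_cmult: "\<Theta> (signed_density M (\<lambda>x. c * f x)) = (\<lambda>B. c * \<Theta> (signed_density M f) B)"
    if "strongly_sigma_additive M N (Mp p M) \<Theta>" "f \<in> Lp p M" for c f \<Theta>
    using that by (simp add: strongly_sigma_additive_def signed_density_cmult Mp)
  \<comment> \<open>Membership in \<open>Lp\<close> is carried through the induction because
    additivity needs it for the tail of the sum.\<close>
  have step: "(\<lambda>x. \<Sum>y\<in>Y. y * indicator (A y) x) \<in> Lp p M \<and>
      \<Phi> (signed_density M (\<lambda>x. \<Sum>y\<in>Y. y * indicator (A y) x)) =
      \<Psi> (signed_density M (\<lambda>x. \<Sum>y\<in>Y. y * indicator (A y) x))"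
    if "finite Y" "\<And>y. A y \<in> sets M" for Y :: "real set" and A
    using that(1)
  proof induction
    case empty
    show ?case
      using lin_cmult[OF \<Phi>(2) Lp_one[OF fin(1)], of 0] lin_cmult[OF \<Psi>(2) Lp_one[OF fin(1)], of 0]
        Lp_cmult[OF Lp_one[OF fin(1)], of 0] by simp
  next
    case (insert y Y)
    have i: "indicator (A y) \<in> Lp p M" using that(2) by (intro Lp_indicator fin)
    note c = Lp_cmult[OF i, of y]
    have "(\<lambda>x. \<Sum>z\<in>insert y Y. z * indicator (A z) x) =
        (\<lambda>x. y * indicator (A y) x + (\<Sum>z\<in>Y. z * indicator (A z) x))"
      by (intro ext sum.insert insert.hyps)
    moreover from insert.IH that(2) have
      "\<Phi> (signed_density M (\<lambda>x. y * indicator (A y) x + (\<Sum>z\<in>Y. z * indicator (A z) x))) =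
       \<Psi> (signed_density M (\<lambda>x. y * indicator (A y) x + (\<Sum>z\<in>Y. z * indicator (A z) x)))"
      by (simp add: lin_add[OF \<Phi>(2) c] lin_add[OF \<Psi>(2) c] lin_cmult[OF \<Phi>(2) i]
          lin_cmult[OF \<Psi>(2) i] ind)
    ultimately show ?case using Lp_add[OF c] insert.IH by simp
  qed
  have simple: "\<Phi> (signed_density M g) = \<Psi> (signed_density M g)"
    if g: "simple_function M g" for g :: "'a \<Rightarrow> real"
  proof -
    let ?A = "\<lambda>y. g -` {y} \<inter> space M"
    let ?r = "\<lambda>x. \<Sum>y\<in>g ` space M. y * indicator (?A y) x"
    have Y: "finite (g ` space M)" using g by (simp add: simple_function_def)
    have A: "?A y \<in> sets M" for y using simple_functionD(2)[OF g] by auto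
    \<comment> \<open>The canonical sum equals \<open>g\<close> only on \<open>space M\<close>,
      since it is \<open>0\<close> outside; almost-everywhere equality is enough for the
      densities.\<close>
    have "AE x in M. g x = ?r x"
    proof (rule AE_I2)
      fix x assume x: "x \<in> space M"
      have "?r x = (\<Sum>y\<in>g ` space M. if y = g x then y else 0)"
        using x by (intro sum.cong) (auto simp: indicator_def)
      then show "g x = ?r x" using x Y by (simp add: sum.delta)
    qed
    then have "signed_density M g = signed_density M ?r"
      by (intro signed_density_cong_AE borel_measurable_simple_function[OF g]
          Lp_measurable[OF step[OF Y A, THEN conjunct1]])
    then show ?thesis using step[OF Y A] by simp
  qed
  have "\<Phi> (signed_density M f) B = \<Psi> (signed_density M f) B"
    if f: "f \<in> Lp p M" and B: "B \<in> sets N" for f B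
  proof -
    have [measurable]: "f \<in> borel_measurable M" using f by (rule Lp_measurable)
    \<comment> \<open>The bound \<open>|F i| <= 2 * |f|\<close> serves twice: it places
      \<open>F i\<close> in \<open>Lp\<close>, and it yields the dominating function
      \<open>3 * |f|\<close> for \<open>L^1\<close> convergence.\<close>
    from borel_measurable_implies_sequence_metric[OF this, of 0] obtain F where
      F: "\<And>i. simple_function M (F i)" "\<And>x. x \<in> space M \<Longrightarrow> (\<lambda>i. F i x) \<longlonglongrightarrow> f x"
        "\<And>i x. x \<in> space M \<Longrightarrow> \<bar>F i x\<bar> \<le> 2 * \<bar>f x\<bar>"
      unfolding dist_real_def diff_0_right by metis
    have [measurable]: "F i \<in> borel_measurable M" for i
      by (rule borel_measurable_simple_function[OF F(1)])
    have FL: "F i \<in> Lp p M" for i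
      using F(3) by (intro Lp_bound[OF f, where C=2]) auto
    have D: "integrable M (\<lambda>x. F i x - f x)" for i
      using FL f by (intro Lp_integrable[OF fin] Lp_diff)
    have "(\<lambda>i. LINT x|M. \<bar>F i x - f x\<bar>) \<longlonglongrightarrow> (LINT x|M. 0)"
    proof (rule integral_dominated_convergence[where w="\<lambda>x. 3 * \<bar>f x\<bar>"])
      show "integrable M (\<lambda>x. 3 * \<bar>f x\<bar>)" using Lp_integrable[OF fin f] by simp
      show "AE x in M. (\<lambda>i. \<bar>F i x - f x\<bar>) \<longlonglongrightarrow> 0"
        using F(2) by (intro AE_I2 tendsto_rabs_zero) (simp add: LIM_zero)
      show "AE x in M. norm \<bar>F i x - f x\<bar> \<le> 3 * \<bar>f x\<bar>" for i
        using F(3)[of _ i] by (intro AE_I2) (smt (verit) real_norm_def)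
    qed auto
    then have L1: "(\<lambda>i. LINT x|M. \<bar>F i x - f x\<bar>) \<longlonglongrightarrow> 0" by simp
    have lim: "(\<lambda>i. \<Theta> (signed_density M (F i)) B) \<longlonglongrightarrow> \<Theta> (signed_density M f) B"
      if \<Theta>: "strongly_sigma_additive M N (Mp p M) \<Theta>" for \<Theta>
      unfolding tendsto_iff
    proof (intro allI impI)
      fix e :: real assume e: "0 < e"
      let ?l = "signed_density M f"
      obtain d where d: "0 < d" "\<And>k. k \<in> Mp p M \<Longrightarrow>
          total_variation M (\<lambda>A. k A - ?l A) < ennreal d \<Longrightarrow>
          total_variation N (\<lambda>B. \<Theta> k B - \<Theta> ?l B) < ennreal e"
        using \<Theta> Mp[OF f] e unfolding strongly_sigma_additive_def by meson
      have "\<forall>\<^sub>F i in sequentially. (LINT x|M. \<bar>F i x - f x\<bar>) < d"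
        using order_tendstoD(2)[OF L1 d(1)] .
      then show "\<forall>\<^sub>F i in sequentially. dist (\<Theta> (signed_density M (F i)) B) (\<Theta> ?l B) < e"
      proof eventually_elim
        case (elim i)
        have "total_variation M (\<lambda>A. signed_density M (F i) A - ?l A) =
            ennreal (LINT x|M. \<bar>F i x - f x\<bar>)"
          using total_variation_signed_density[OF D, of i]
          by (simp add: signed_density_diff Lp_integrable[OF fin] FL f)
        also have "\<dots> < ennreal d" using elim by (simp add: ennreal_lessI d)
        finally have "total_variation N (\<lambda>B. \<Theta> (signed_density M (F i)) B - \<Theta> ?l B) < ennreal e"
          by (intro d Mp FL)
        with abs_le_total_variation[OF B, of "\<lambda>B. \<Theta> (signed_density M (F i)) B - \<Theta> ?l B"]
        have "ennreal \<bar>\<Theta> (signed_density M (F i)) B - \<Theta> ?l B\<bar> < ennreal e"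
          by (rule le_less_trans)
        then show ?case by (simp add: dist_real_def ennreal_less_iff)
      qed
    qed
    show ?thesis
      using LIMSEQ_unique[OF lim[OF \<Phi>(2)]] lim[OF \<Psi>(2)] by (simp add: simple F(1))
  qed
  then have "\<Phi> l B = \<Psi> l B" if "l \<in> Mp p M" for l B
    using that out[OF \<Phi>(1) that] out[OF \<Psi>(1) that] by (cases "B \<in> sets N") (auto simp: Mp_def)
  then show ?thesis
    using \<Phi>(1) \<Psi>(1) by (intro PiE_ext) (auto simp: transfunction_def fun_eq_iff)
qed

section \<open>From Markov transfunctions to Markov operators\<close>

text \<open>Linearity and positivity of \<open>\<Phi>\<close>, read off on densities. Coefficients
  \<open>1\<close> and \<open>0\<close> give a nonnegative density of \<open>\<Phi> l\<close>;
  \<open>C\<close> with \<open>1\<close> or \<open>-1\<close> gives the two-sided bound on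
  \<open>g\<close>.\<close>

lemma transfunction_density_nonneg:
  assumes fin: "finite_measure M" "finite_measure N" "1 \<le> p"
    and \<Phi>: "markov_transfunction M N (Mp p M) (Mp p N) \<Phi>"
    and f: "f \<in> Lp p M" "g \<in> Lp p N" "\<Phi> (signed_density M f) = signed_density N g"
    and h: "h \<in> Lp p M" "k \<in> Lp p N" "\<Phi> (signed_density M h) = signed_density N k"
    and pos: "AE x in M. 0 \<le> a * h x + c * f x"
  shows "AE y in N. 0 \<le> a * k y + c * g y"
proof -
  note intM = Lp_integrable[OF fin(1,3)] and intN = Lp_integrable[OF fin(2,3)]
  have Mp: "signed_density M f \<in> Mp p M" if "f \<in> Lp p M" for f
    using that by (auto simp: Mp_def)
  have ssa: "strongly_sigma_additive M N (Mp p M) \<Phi>"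
    and nonneg: "\<And>l. l \<in> Mp p M \<Longrightarrow> nonneg_measure M l \<Longrightarrow> nonneg_measure N (\<Phi> l)"
    using \<Phi> by (auto simp: markov_transfunction_def)
  have lin: "(\<lambda>x. a * h x + c * f x) \<in> Lp p M" "(\<lambda>y. a * k y + c * g y) \<in> Lp p N"
    "(\<lambda>x. a * h x) \<in> Lp p M" "(\<lambda>x. c * f x) \<in> Lp p M"
    "(\<lambda>x. a * k x) \<in> Lp p N" "(\<lambda>x. c * g x) \<in> Lp p N"
    using f h by (auto intro!: Lp_add Lp_cmult)
  have "\<Phi> (signed_density M (\<lambda>x. a * h x + c * f x)) =
      (\<lambda>B. \<Phi> (signed_density M (\<lambda>x. a * h x)) B + \<Phi> (signed_density M (\<lambda>x. c * f x)) B)"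
    using ssa lin(3,4)
    by (simp add: signed_density_add[OF intM intM, OF lin(3,4)] strongly_sigma_additive_def Mp)
  also have "\<dots> = (\<lambda>B. a * signed_density N k B + c * signed_density N g B)"
    using ssa by (simp add: signed_density_cmult strongly_sigma_additive_def Mp f h)
  also have "\<dots> = signed_density N (\<lambda>y. a * k y + c * g y)"
    by (simp add: signed_density_add[OF intN intN, OF lin(5,6)] signed_density_cmult)
  finally show ?thesis
    using nonneg[OF Mp[OF lin(1)]] pos lin by (simp add: nonneg_signed_density_iff fin intM intN)
qed

text \<open>The exponent infinity on \<open>L\<close> is what keeps \<open>h * f\<close> in
  \<open>Lp p M\<close>, the domain on which \<open>\<Phi>\<close> acts: a bounded \<open>f\<close>
  gives \<open>|h * f| <= C * h\<close>.\<close>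

lemma markov_transfunction_induces_operator:
  assumes fin: "finite_measure M" "finite_measure N" "1 \<le> p"
    and \<Phi>: "markov_transfunction M N (Mp p M) (Mp p N) \<Phi>"
    and l: "l \<in> Mp_pos p M"
  defines "L \<equiv> to_measure M l" and "R \<equiv> to_measure N (\<Phi> l)"
  shows "\<exists>T. markov_operator \<infinity> L R T \<and>
    (\<forall>f\<in>Lp \<infinity> L. signed_density R (T f) = \<Phi> (signed_density L f))"
proof -
  note intM = Lp_integrable[OF fin(1,3)] and intN = Lp_integrable[OF fin(2,3)]
  have Mp: "signed_density M f \<in> Mp p M" if "f \<in> Lp p M" for f
    using that by (auto simp: Mp_def)
  have ssa: "strongly_sigma_additive M N (Mp p M) \<Phi>"
    and nonneg: "\<And>l. l \<in> Mp p M \<Longrightarrow> nonneg_measure M l \<Longrightarrow> nonneg_measure N (\<Phi> l)"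
    and mass: "\<And>l. l \<in> Mp p M \<Longrightarrow> \<Phi> l (space N) = l (space M)"
    and img: "\<And>l. l \<in> Mp p M \<Longrightarrow> \<Phi> l \<in> Mp p N"
    using \<Phi> by (auto simp: markov_transfunction_def transfunction_def)
  obtain h where h: "h \<in> Lp p M" "AE x in M. 0 \<le> h x" and lh: "l = signed_density M h"
    using l by (auto simp: Mp_pos_def)
  obtain k where k: "k \<in> Lp p N" and lk: "\<Phi> (signed_density M h) = signed_density N k"
    using img[OF Mp[OF h(1)]] by (auto simp: Mp_def)
  have k0: "AE y in N. 0 \<le> k y"
    using transfunction_density_nonneg[OF fin \<Phi> h(1) k lk h(1) k lk, of 1 0] h(2) by simp
  have L: "L = density M (\<lambda>x. ennreal (h x))" and R: "R = density N (\<lambda>y. ennreal (k y))"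
    unfolding L_def R_def lh lk using h k k0 by (auto intro!: to_measure_signed_density intM intN)
  have [measurable]: "h \<in> borel_measurable M" "k \<in> borel_measurable N"
    using h k by (auto intro: Lp_measurable)
  have setsLR[simp]: "sets L = sets M" "space L = space M" "sets R = sets N" "space R = space N"
    unfolding L R by auto
  have finLR: "finite_measure L" "finite_measure R"
    unfolding L R
    using intM[OF h(1)] intN[OF k]
    by (auto intro!: finite_measureI simp: emeasure_density nn_integral_eq_integral h k0
        cong: nn_integral_cong)
  have sdL: "signed_density L f = signed_density M (\<lambda>x. h x * f x)" if "f \<in> borel_measurable M" for f
    unfolding L using that h by (intro signed_density_density) auto
  have sdR: "signed_density R f = signed_density N (\<lambda>x. k x * f x)" if "f \<in> borel_measurable N" for f
    unfolding R using that k0 by (intro signed_density_density) auto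
  have measL: "f \<in> borel_measurable L \<longleftrightarrow> f \<in> borel_measurable M" for f :: "_ \<Rightarrow> real"
    unfolding L by simp
  have measR: "f \<in> borel_measurable R \<longleftrightarrow> f \<in> borel_measurable N" for f :: "_ \<Rightarrow> real"
    unfolding R by simp
  have bound: "\<exists>C. AE x in M. \<bar>h x * f x\<bar> \<le> C * h x" if f: "f \<in> Lp \<infinity> L" for f
  proof -
    have [measurable]: "f \<in> borel_measurable M" using Lp_measurable[OF f] measL by simp
    obtain C where "AE x in L. \<bar>f x\<bar> \<le> C" using f by (auto simp: Lp_def)
    \<comment> \<open>An \<open>L\<close>-almost-everywhere bound says nothing about
      \<open>f\<close> where \<open>h\<close> vanishes, but \<open>h * f\<close> vanishes there
      too.\<close>
    then have "AE x in M. 0 < h x \<longrightarrow> \<bar>f x\<bar> \<le> C"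
      unfolding L by (subst (asm) AE_density) auto
    with h(2) have "AE x in M. \<bar>h x * f x\<bar> \<le> C * h x"
    proof eventually_elim
      case (elim x)
      then show ?case by (cases "h x = 0") (auto simp: abs_mult mult.commute[of C] intro: mult_left_mono)
    qed
    then show ?thesis by blast
  qed
  have hf: "(\<lambda>x. h x * f x) \<in> Lp p M" if f: "f \<in> Lp \<infinity> L" for f
  proof -
    have [measurable]: "f \<in> borel_measurable M" using Lp_measurable[OF f] measL by simp
    obtain C where "AE x in M. \<bar>h x * f x\<bar> \<le> C * h x" using bound[OF f] by blast
    with h(2) have "AE x in M. \<bar>h x * f x\<bar> \<le> C * \<bar>h x\<bar>" by eventually_elim auto
    then show ?thesis by (intro Lp_bound[OF h(1)]) auto
  qed
  have sdL_Mp: "signed_density L f \<in> Mp p M" if f: "f \<in> Lp \<infinity> L" for f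
    using hf[OF f] Lp_measurable[OF f] by (simp add: sdL measL Mp)
  have ex: "\<exists>t. t \<in> Lp \<infinity> R \<and> signed_density R t = \<Phi> (signed_density L f)" if f: "f \<in> Lp \<infinity> L" for f
  proof -
    obtain g where g: "g \<in> Lp p N" "\<Phi> (signed_density M (\<lambda>x. h x * f x)) = signed_density N g"
      using img[OF Mp[OF hf[OF f]]] by (auto simp: Mp_def)
    have [measurable]: "g \<in> borel_measurable N" using g by (auto intro: Lp_measurable)
    obtain C where C: "AE x in M. \<bar>h x * f x\<bar> \<le> C * h x" using bound[OF f] by blast
    \<comment> \<open>The two signs of \<open>c\<close> squeeze \<open>g\<close> between
      \<open>- C * k\<close> and \<open>C * k\<close>.\<close>
    have "AE y in N. 0 \<le> C * k y + c * g y" if "\<bar>c\<bar> = 1" for c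
    proof (rule transfunction_density_nonneg[OF fin \<Phi> hf[OF f] g h(1) k lk])
      show "AE x in M. 0 \<le> C * h x + c * (h x * f x)"
        using C by eventually_elim (use that in \<open>auto simp: abs_if split: if_splits\<close>)
    qed
    from this[of 1] this[of "-1"] have gk: "AE y in N. \<bar>g y\<bar> \<le> C * k y" by auto
    have "AE y in N. 0 < k y \<longrightarrow> \<bar>g y / k y\<bar> \<le> C"
      using gk by eventually_elim (auto simp: field_simps)
    then have "AE y in R. \<bar>g y / k y\<bar> \<le> C"
      unfolding R by (subst AE_density) auto
    then have t: "(\<lambda>y. g y / k y) \<in> Lp \<infinity> R"
      by (auto simp: Lp_def measR)
    \<comment> \<open>Where \<open>k y = 0\<close>, the junk value \<open>g y / 0 = 0\<close> is right, since there \<open>g y = 0\<close> as well.\<close>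
    have "AE y in N. k y * (g y / k y) = g y"
      using gk by eventually_elim auto
    then have "signed_density R (\<lambda>y. g y / k y) = signed_density N g"
      by (subst sdR) (auto intro!: signed_density_cong_AE)
    then show ?thesis using t g(2) sdL[of f] Lp_measurable[OF f] by (auto simp: measL)
  qed
  \<comment> \<open>The choice itself gives no linearity. The measure
    \<open>signed_density R (T f)\<close> is fixed by \<open>f\<close>, though, so each property
    below is checked on measures and returned by uniqueness of densities.\<close>
  define T where "T f = (SOME t. t \<in> Lp \<infinity> R \<and> signed_density R t = \<Phi> (signed_density L f))" for f
  have T: "T f \<in> Lp \<infinity> R" "signed_density R (T f) = \<Phi> (signed_density L f)" if "f \<in> Lp \<infinity> L" for f
    using someI_ex[OF ex[OF that]] by (auto simp: T_def)
  have intL: "integrable L f" if "f \<in> Lp \<infinity> L" for f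
    using Lp_integrable[OF finLR(1) _ that] by simp
  have intR: "integrable R f" if "f \<in> Lp \<infinity> R" for f
    using Lp_integrable[OF finLR(2) _ that] by simp
  \<comment> \<open>The indicators of the whole spaces play the constant \<open>1\<close>; these
    identities yield both equality of masses and \<open>T 1 = 1\<close>.\<close>
  have one: "signed_density L (indicator (space M)) = l" "signed_density R (indicator (space N)) = \<Phi> l"
    unfolding sdL[OF borel_measurable_indicator[OF sets.top]]
      sdR[OF borel_measurable_indicator[OF sets.top]] lh lk
    by (auto intro!: signed_density_cong_AE AE_I2)
  have i1: "indicator (space M) \<in> Lp \<infinity> L" "indicator (space N) \<in> Lp \<infinity> R"
    by (auto intro!: Lp_indicator finLR)
  have mass_eq: "measure L (space M) = measure R (space N)"
  proof -
    have "measure L (space M) = l (space M)"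
      unfolding one(1)[symmetric] using signed_density_space[of L] finLR by simp
    moreover have "measure R (space N) = \<Phi> l (space N)"
      unfolding one(2)[symmetric] using signed_density_space[of R] finLR by simp
    ultimately show ?thesis using mass[of l] Mp[OF h(1)] lh by simp
  qed
  have "markov_operator \<infinity> L R T"
    unfolding markov_operator_def
  proof (intro conjI ballI allI impI finLR)
    show "1 \<le> (\<infinity>::ennreal)" by simp
    show "total_variation L (measure L) = total_variation R (measure R)"
      using mass_eq by (simp add: total_variation_measure finLR)
    show "T f \<in> Lp \<infinity> R" if "f \<in> Lp \<infinity> L" for f using T that by simp
    show "AE y in R. T f y = T g y"
      if "f \<in> Lp \<infinity> L" "g \<in> Lp \<infinity> L" "AE x in L. f x = g x" for f g
      using that signed_density_cong_AE[of f L g]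
      by (intro signed_density_eq_AE intR T) (auto simp: T Lp_measurable)
    show "AE y in R. T (\<lambda>x. f x + g x) y = T f y + T g y"
      if "f \<in> Lp \<infinity> L" "g \<in> Lp \<infinity> L" for f g
      using that ssa
      by (intro signed_density_eq_AE intR Lp_add T)
        (auto simp: T Lp_add signed_density_add intL intR[OF T(1)] strongly_sigma_additive_def sdL_Mp)
    show "AE y in R. T (\<lambda>x. c * f x) y = c * T f y" if "f \<in> Lp \<infinity> L" for c f
      using that ssa
      by (intro signed_density_eq_AE intR Lp_cmult T)
        (auto simp: T Lp_cmult signed_density_cmult strongly_sigma_additive_def sdL_Mp)
    show "AE y in R. T (indicator (space L)) y = indicator (space R) y"
      using i1 one by (intro signed_density_eq_AE intR T) (auto simp: T)
    show "AE y in R. 0 \<le> T f y" if f: "f \<in> Lp \<infinity> L" "AE x in L. 0 \<le> f x" for f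
    proof -
      \<comment> \<open>\<open>nonneg_measure\<close> depends only on the sigma-algebra, which
        \<open>L\<close> shares with \<open>M\<close> and \<open>R\<close> with \<open>N\<close>, so
        the base measure may be exchanged.\<close>
      have "nonneg_measure M (signed_density L f)"
        using nonneg_signed_density_iff[OF finLR(1) intL[OF f(1)]] f(2) by (simp add: nonneg_measure_def)
      from nonneg[OF sdL_Mp[OF f(1)] this] have "nonneg_measure R (signed_density R (T f))"
        using T[OF f(1)] by (simp add: nonneg_measure_def)
      then show ?thesis using nonneg_signed_density_iff[OF finLR(2) intR[OF T(1)[OF f(1)]]] by simp
    qed
    show "(LINT x|L. f x) = (LINT y|R. T f y)" if f: "f \<in> Lp \<infinity> L" for f
      using mass[OF sdL_Mp[OF f]] T(2)[OF f] signed_density_space[of L f] signed_density_space[of R "T f"]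
      by simp
  qed
  then show ?thesis using T(2) by blast
qed

section \<open>Both correspondences, specialised to indicators\<close>

theorem theorem2p5:
  fixes \<mu> :: "'a measure" and \<nu> :: "'b measure" and s :: ennreal
  assumes "finite_measure \<mu>" and "finite_measure \<nu>"
    and "total_variation \<mu> (measure \<mu>) = total_variation \<nu> (measure \<nu>)"
    and "1 \<le> s"
  shows "(\<forall>T. markov_operator s \<mu> \<nu> T \<longrightarrow>
            (\<exists>!\<Phi>. markov_transfunction \<mu> \<nu> (Mp s \<mu>) (Mp s \<nu>) \<Phi> \<and>
               (\<forall>A\<in>sets \<mu>. \<forall>B\<in>sets \<nu>.
                  (LINT y:B|\<nu>. T (indicator A) y) = \<Phi> (signed_density \<mu> (indicator A)) B)))
       \<and> (\<forall>\<Phi>. markov_transfunction \<mu> \<nu> (Mp s \<mu>) (Mp s \<nu>) \<Phi> \<longrightarrow>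
            (\<forall>l\<in>Mp_pos s \<mu>.
               let L = to_measure \<mu> l; R = to_measure \<nu> (\<Phi> l) in
               \<exists>T. markov_operator \<infinity> L R T \<and>
                 (\<forall>A\<in>sets \<mu>. \<forall>B\<in>sets \<nu>.
                    (LINT y:B|R. T (indicator A) y) = \<Phi> (signed_density L (indicator A)) B)))"
proof (intro conjI allI impI ballI)
  fix T assume T: "markov_operator s \<mu> \<nu> T"
  obtain \<Phi> where \<Phi>: "markov_transfunction \<mu> \<nu> (Mp s \<mu>) (Mp s \<nu>) \<Phi>"
    and sd: "\<And>f. f \<in> Lp s \<mu> \<Longrightarrow> \<Phi> (signed_density \<mu> f) = signed_density \<nu> (T f)"
    using markov_operator_induces_transfunction[OF T] by blast
  show "\<exists>!\<Phi>. markov_transfunction \<mu> \<nu> (Mp s \<mu>) (Mp s \<nu>) \<Phi> \<and>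
      (\<forall>A\<in>sets \<mu>. \<forall>B\<in>sets \<nu>.
        (LINT y:B|\<nu>. T (indicator A) y) = \<Phi> (signed_density \<mu> (indicator A)) B)"
  proof (rule ex1I[of _ \<Phi>])
    show *: "markov_transfunction \<mu> \<nu> (Mp s \<mu>) (Mp s \<nu>) \<Phi> \<and>
      (\<forall>A\<in>sets \<mu>. \<forall>B\<in>sets \<nu>.
        (LINT y:B|\<nu>. T (indicator A) y) = \<Phi> (signed_density \<mu> (indicator A)) B)"
      using \<Phi> sd[OF Lp_indicator[OF assms(1)]] by (simp add: signed_density_def)
    fix \<Psi> assume "markov_transfunction \<mu> \<nu> (Mp s \<mu>) (Mp s \<nu>) \<Psi> \<and>
      (\<forall>A\<in>sets \<mu>. \<forall>B\<in>sets \<nu>.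
        (LINT y:B|\<nu>. T (indicator A) y) = \<Psi> (signed_density \<mu> (indicator A)) B)"
    with * show "\<Psi> = \<Phi>"
      by (intro transfunction_eqI[OF assms(1,4)]) (auto simp: markov_transfunction_def)
  qed
next
  fix \<Phi> l assume \<Phi>: "markov_transfunction \<mu> \<nu> (Mp s \<mu>) (Mp s \<nu>) \<Phi>" and l: "l \<in> Mp_pos s \<mu>"
  let ?L = "to_measure \<mu> l" and ?R = "to_measure \<nu> (\<Phi> l)"
  have sets: "sets ?L = sets \<mu>" "sets ?R = sets \<nu>"
    by (simp_all add: to_measure_def sets.space_closed sets.sigma_sets_eq)
  obtain T where T: "markov_operator \<infinity> ?L ?R T"
    and sd: "\<And>f. f \<in> Lp \<infinity> ?L \<Longrightarrow> signed_density ?R (T f) = \<Phi> (signed_density ?L f)"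
    using markov_transfunction_induces_operator[OF assms(1,2,4) \<Phi> l] by blast
  have "(LINT y:B|?R. T (indicator A) y) = \<Phi> (signed_density ?L (indicator A)) B"
    if "A \<in> sets \<mu>" "B \<in> sets \<nu>" for A B
  proof -
    \<comment> \<open>Finiteness of \<open>?L\<close> is read off from \<open>T\<close> being a
      Markov operator on it.\<close>
    have "indicator A \<in> Lp \<infinity> ?L"
      using T that by (intro Lp_indicator) (auto simp: markov_operator_def sets)
    from sd[OF this, symmetric] that show ?thesis by (simp add: signed_density_def sets)
  qed
  with T show "let L = to_measure \<mu> l; R = to_measure \<nu> (\<Phi> l) in
      \<exists>T. markov_operator \<infinity> L R T \<and> (\<forall>A\<in>sets \<mu>. \<forall>B\<in>sets \<nu>.
        (LINT y:B|R. T (indicator A) y) = \<Phi> (signed_density L (indicator A)) B)"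
    unfolding Let_def by blast
qed

end
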